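(* Let $p>0$, $q\ge0$ and $a$ be real numbers. Then $$m_{p,q,a}(x)=\mathrm{INVERT}_{-a}\bigl(\mathrm{MINVERT}_{p-q}(g_{a,q})\bigr)(x).$$
   Context: $\mathcal{J}(\alpha_1,\alpha_2,\ldots;\beta_1,\beta_2,\ldots)$ denotes the formal power series in $x$ given by the Jacobi continued fraction $$\cfrac{1}{1-\alpha_1x-\cfrac{\beta_1x^2}{1-\alpha_2x-\cfrac{\beta_2x^2}{1-\alpha_3x-\cdots}}},$$ understood as the limit of its finite truncations in the $x$-adic topology. Set $g_{a,q}(x)=\mathcal{J}(a,a,a,\ldots;q,q,q,\ldots)$ and $m_{p,q,a}(x)=\mathcal{J}(0,a,a,a,\ldots;p,q,q,q,\ldots)$; the latter is the moment generating function of the free Meixner law with parameters $(p,q,a)$. For a formal power series $g$ and a real number $r$, $\mathrm{INVERT}_r(g)(x)=\frac{g(x)}{1-rx\,g(x)}$ and $\mathrm{MINVERT}_r(g)(x)=\frac{g(x)}{1-r\,x^2g(x)^2}$. *)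

theory Defs
  imports "HOL-Computational_Algebra.Formal_Power_Series"
begin

(* The truncation to n levels of the continued fraction whose top level carries the index k;
   the coefficient sequences are indexed from 1. Every denominator has constant term 1. *)
fun jacobi_cf_trunc :: "(nat \<Rightarrow> real) \<Rightarrow> (nat \<Rightarrow> real) \<Rightarrow> nat \<Rightarrow> nat \<Rightarrow> real fps" where
  "jacobi_cf_trunc \<alpha> \<beta> k 0 = 0"
| "jacobi_cf_trunc \<alpha> \<beta> k (Suc n) =
     1 / (1 - fps_const (\<alpha> k) * fps_X
            - fps_const (\<beta> k) * fps_X ^ 2 * jacobi_cf_trunc \<alpha> \<beta> (Suc k) n)"

(* The metric topology of the type fps is the X-adic one. *)
definition jacobi_cf :: "(nat \<Rightarrow> real) \<Rightarrow> (nat \<Rightarrow> real) \<Rightarrow> real fps" where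
  "jacobi_cf \<alpha> \<beta> = lim (\<lambda>n. jacobi_cf_trunc \<alpha> \<beta> 1 n)"

definition g_series :: "real \<Rightarrow> real \<Rightarrow> real fps" where
  "g_series a q = jacobi_cf (\<lambda>_. a) (\<lambda>_. q)"

definition free_meixner_mgf :: "real \<Rightarrow> real \<Rightarrow> real \<Rightarrow> real fps" where
  "free_meixner_mgf p q a =
     jacobi_cf (\<lambda>i. if i = 1 then 0 else a) (\<lambda>i. if i = 1 then p else q)"

definition INVERT :: "real \<Rightarrow> real fps \<Rightarrow> real fps" where
  "INVERT r g = g / (1 - fps_const r * fps_X * g)"

definition MINVERT :: "real \<Rightarrow> real fps \<Rightarrow> real fps" where
  "MINVERT r g = g / (1 - fps_const r * fps_X ^ 2 * g ^ 2)"

lemma jacobi_cf_trunc_dvd_diff: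
  "fps_X ^ n dvd jacobi_cf_trunc \<alpha> \<beta> k (Suc n) - jacobi_cf_trunc \<alpha> \<beta> k n"
proof (induction n arbitrary: k)
  case 0
  then show ?case by simp
next
  case (Suc n)
  let ?D = "\<lambda>m. 1 - fps_const (\<alpha> k) * fps_X
              - fps_const (\<beta> k) * fps_X ^ 2 * jacobi_cf_trunc \<alpha> \<beta> (Suc k) m"
  have nz: "fps_nth (?D m) 0 \<noteq> 0" for m
    by (simp add: power2_eq_square)
  have inv: "inverse (?D m) * ?D m = 1" for m
    by (rule inverse_mult_eq_1[OF nz])
  have T: "jacobi_cf_trunc \<alpha> \<beta> k (Suc m) = inverse (?D m)" for m
    using fps_divide_unit[OF nz, of 1 m] by simp
  have "inverse (?D (Suc n)) - inverse (?D n)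
      = inverse (?D (Suc n)) * (?D n * inverse (?D n))
        - inverse (?D (Suc n)) * ?D (Suc n) * inverse (?D n)"
    using inv by (simp only: mult.commute mult_1_left mult_1_right)
  also have "\<dots> = inverse (?D (Suc n)) * inverse (?D n) * (?D n - ?D (Suc n))"
    by (simp only: algebra_simps)
  also have "?D n - ?D (Suc n) = fps_const (\<beta> k) * fps_X ^ 2 *
      (jacobi_cf_trunc \<alpha> \<beta> (Suc k) (Suc n) - jacobi_cf_trunc \<alpha> \<beta> (Suc k) n)"
    by (simp only: algebra_simps)
  finally have eq: "inverse (?D (Suc n)) - inverse (?D n) =
      (inverse (?D (Suc n)) * inverse (?D n) * fps_const (\<beta> k) * fps_X) *
      (fps_X * (jacobi_cf_trunc \<alpha> \<beta> (Suc k) (Suc n) - jacobi_cf_trunc \<alpha> \<beta> (Suc k) n))"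
    by (simp only: power2_eq_square mult.assoc)
  have "fps_X ^ Suc n dvd
      fps_X * (jacobi_cf_trunc \<alpha> \<beta> (Suc k) (Suc n) - jacobi_cf_trunc \<alpha> \<beta> (Suc k) n)"
    unfolding power_Suc by (rule mult_dvd_mono[OF dvd_refl Suc.IH])
  then show ?case
    unfolding T eq by (rule dvd_mult)
qed

lemma jacobi_cf_trunc_nth_eq:
  assumes "i < n"
  shows "fps_nth (jacobi_cf_trunc \<alpha> \<beta> k n) i = fps_nth (jacobi_cf_trunc \<alpha> \<beta> k (Suc i)) i"
  using Suc_leI[OF assms]
proof (induction n rule: dec_induct)
  case base
  then show ?case by simp
next
  case (step m)
  obtain d where "jacobi_cf_trunc \<alpha> \<beta> k (Suc m) - jacobi_cf_trunc \<alpha> \<beta> k m = fps_X ^ m * d"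
    using jacobi_cf_trunc_dvd_diff by (rule dvdE)
  then have "fps_nth (jacobi_cf_trunc \<alpha> \<beta> k (Suc m) - jacobi_cf_trunc \<alpha> \<beta> k m) i = 0"
    using step.hyps by (simp add: fps_X_power_mult_nth del: jacobi_cf_trunc.simps)
  then show ?case
    using step.IH by (simp del: jacobi_cf_trunc.simps)
qed

lemma jacobi_cf_trunc_tendsto: "(\<lambda>n. jacobi_cf_trunc \<alpha> \<beta> 1 n) \<longlonglongrightarrow> jacobi_cf \<alpha> \<beta>"
proof -
  have "(\<lambda>n. jacobi_cf_trunc \<alpha> \<beta> 1 n) \<longlonglongrightarrow>
          Abs_fps (\<lambda>i. fps_nth (jacobi_cf_trunc \<alpha> \<beta> 1 (Suc i)) i)"
  proof (rule tendsto_fpsI)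
    fix i
    show "\<forall>\<^sub>F n in sequentially. fps_nth (jacobi_cf_trunc \<alpha> \<beta> 1 n) i =
        fps_nth (Abs_fps (\<lambda>i. fps_nth (jacobi_cf_trunc \<alpha> \<beta> 1 (Suc i)) i)) i"
      unfolding fps_nth_Abs_fps
      by (rule eventually_mono[OF eventually_gt_at_top[of i]]) (rule jacobi_cf_trunc_nth_eq)
  qed
  then show ?thesis
    unfolding jacobi_cf_def by (simp add: limI)
qed

end

theory Submission
  imports Defs
begin

text \<open>
  Write \<open>x\<close> for the indeterminate. Removing the top level of a Jacobi continued fraction leaves
  the Jacobi continued fraction of the shifted coefficient sequences. A constant sequence is its
  own shift, so \<open>g = g_series a q\<close> solves the quadratic equation \<open>g (1 - a x - q x\<^sup>2 g) = 1\<close>;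
  and the coefficients of the free Meixner fraction are constant from the second level on, so
  its generating function is \<open>1 / (1 - p x\<^sup>2 g)\<close>.

  On the other side, the composite of the two transforms is the single quotient
  \<open>g / (1 - r x\<^sup>2 g\<^sup>2 - s x g)\<close> with \<open>r = p - q\<close> and \<open>s = - a\<close>. The quadratic equation says
  that \<open>1 + a x g + q x\<^sup>2 g\<^sup>2 = g\<close>, so this denominator is \<open>g (1 - p x\<^sup>2 g)\<close>, and the factor
  \<open>g\<close> cancels.
\<close>

lemma tendsto_fps_diff:
  fixes F G :: "'b \<Rightarrow> 'a::group_add fps"
  assumes "(F \<longlongrightarrow> f) A" and "(G \<longlongrightarrow> g) A"
  shows "((\<lambda>n. F n - G n) \<longlongrightarrow> f - g) A"
proof (rule tendsto_fpsI)
  fix i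
  from assms have "\<forall>\<^sub>F n in A. fps_nth (F n) i = fps_nth f i"
    and "\<forall>\<^sub>F n in A. fps_nth (G n) i = fps_nth g i"
    unfolding tendsto_fps_iff by simp_all
  then show "\<forall>\<^sub>F n in A. fps_nth (F n - G n) i = fps_nth (f - g) i"
    by eventually_elim simp
qed

text \<open>
  A coefficient of a product involves only finitely many coefficients of the factors, and these
  are eventually constant.
\<close>

lemma tendsto_fps_mult:
  fixes F G :: "'b \<Rightarrow> 'a::ring fps"
  assumes "(F \<longlongrightarrow> f) A" and "(G \<longlongrightarrow> g) A"
  shows "((\<lambda>n. F n * G n) \<longlongrightarrow> f * g) A"
proof (rule tendsto_fpsI)
  fix i
  from assms have "\<forall>\<^sub>F n in A. \<forall>j\<in>{..i}. fps_nth (F n) j = fps_nth f j"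
    and "\<forall>\<^sub>F n in A. \<forall>j\<in>{..i}. fps_nth (G n) j = fps_nth g j"
    unfolding tendsto_fps_iff by (simp_all add: eventually_ball_finite_distrib)
  then show "\<forall>\<^sub>F n in A. fps_nth (F n * G n) i = fps_nth (f * g) i"
    by eventually_elim (simp add: fps_mult_nth)
qed

lemma jacobi_cf_trunc_shift:
  "jacobi_cf_trunc \<alpha> \<beta> (Suc k) n = jacobi_cf_trunc (\<lambda>i. \<alpha> (Suc i)) (\<lambda>i. \<beta> (Suc i)) k n"
  by (induction n arbitrary: k) simp_all

text \<open>
  Each truncation satisfies this relation with the next shorter truncation of the shifted fraction.
  In product form the relation is polynomial, so it passes to the limit by continuity of the ring
  operations.
\<close>

lemma jacobi_cf_unfold_mult:
  "jacobi_cf \<alpha> \<beta> * (1 - fps_const (\<alpha> 1) * fps_X - fps_const (\<beta> 1) * fps_X ^ 2 *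
     jacobi_cf (\<lambda>i. \<alpha> (Suc i)) (\<lambda>i. \<beta> (Suc i))) = 1"
proof -
  let ?T = "jacobi_cf_trunc \<alpha> \<beta> 1"
  let ?S = "jacobi_cf_trunc (\<lambda>i. \<alpha> (Suc i)) (\<lambda>i. \<beta> (Suc i)) 1"
  let ?D = "\<lambda>s. 1 - fps_const (\<alpha> 1) * fps_X - fps_const (\<beta> 1) * fps_X ^ 2 * s"
  have trunc: "?T (Suc n) * ?D (?S n) = 1" for n
  proof -
    have nz: "fps_nth (?D (?S n)) 0 \<noteq> 0"
      by (simp add: power2_eq_square)
    have "?T (Suc n) = inverse (?D (?S n))"
      using fps_divide_unit[OF nz, of 1] jacobi_cf_trunc_shift[of \<alpha> \<beta> 1 n] by simp
    then show ?thesis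
      using inverse_mult_eq_1[OF nz] by simp
  qed
  have "(\<lambda>n. ?T (Suc n) * ?D (?S n)) \<longlonglongrightarrow>
      jacobi_cf \<alpha> \<beta> * ?D (jacobi_cf (\<lambda>i. \<alpha> (Suc i)) (\<lambda>i. \<beta> (Suc i)))"
    by (intro tendsto_fps_mult tendsto_fps_diff tendsto_const jacobi_cf_trunc_tendsto
        LIMSEQ_Suc)
  then show ?thesis
    unfolding trunc using LIMSEQ_unique[OF tendsto_const] by metis
qed

lemma jacobi_cf_trunc_cong:
  assumes "\<And>i. i \<ge> k \<Longrightarrow> \<alpha> i = \<alpha>' i" and "\<And>i. i \<ge> k \<Longrightarrow> \<beta> i = \<beta>' i"
  shows "jacobi_cf_trunc \<alpha> \<beta> k n = jacobi_cf_trunc \<alpha>' \<beta>' k n"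
  using assms
proof (induction n arbitrary: k)
  case 0
  then show ?case by simp
next
  case (Suc n)
  have "jacobi_cf_trunc \<alpha> \<beta> (Suc k) n = jacobi_cf_trunc \<alpha>' \<beta>' (Suc k) n"
    by (rule Suc.IH) (simp_all add: Suc.prems)
  then show ?case
    by (simp add: Suc.prems)
qed

lemma jacobi_cf_cong:
  assumes "\<And>i. i \<ge> 1 \<Longrightarrow> \<alpha> i = \<alpha>' i" and "\<And>i. i \<ge> 1 \<Longrightarrow> \<beta> i = \<beta>' i"
  shows "jacobi_cf \<alpha> \<beta> = jacobi_cf \<alpha>' \<beta>'"
  unfolding jacobi_cf_def
  by (intro arg_cong[of _ _ lim] ext jacobi_cf_trunc_cong assms)

lemma g_series_quadratic:
  "g_series a q * (1 - fps_const a * fps_X - fps_const q * fps_X ^ 2 * g_series a q) = 1"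
  unfolding g_series_def by (rule jacobi_cf_unfold_mult)

lemma free_meixner_mgf_eq:
  "free_meixner_mgf p q a = 1 / (1 - fps_const p * fps_X ^ 2 * g_series a q)"
proof -
  let ?d = "1 - fps_const p * fps_X ^ 2 * g_series a q"
  \<comment> \<open>The shifted sequences are constant only from index \<open>1\<close> on: the two exceptional coefficients
     sit at index \<open>0\<close>, which the continued fraction never reads.\<close>
  have "jacobi_cf (\<lambda>i. if Suc i = 1 then 0 else a) (\<lambda>i. if Suc i = 1 then p else q)
      = g_series a q"
    unfolding g_series_def by (rule jacobi_cf_cong) simp_all
  then have prod: "free_meixner_mgf p q a * ?d = 1"
    unfolding free_meixner_mgf_def
    using jacobi_cf_unfold_mult[of "\<lambda>i. if i = 1 then 0 else a" "\<lambda>i. if i = 1 then p else q"]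
    by simp
  then have "?d \<noteq> 0"
    by (metis mult_zero_right zero_neq_one)
  from fps_divide_times_eq[OF this, of "free_meixner_mgf p q a"] show ?thesis
    unfolding prod by (rule sym)
qed

text \<open>
  Division of formal power series is exact only by a divisor. The inner denominator has constant
  term 1, hence is a unit, so expanding the outer fraction by it flattens the nested one.
\<close>

lemma INVERT_MINVERT:
  "INVERT s (MINVERT r g) = g / (1 - fps_const r * fps_X ^ 2 * g ^ 2 - fps_const s * fps_X * g)"
proof -
  let ?u = "1 - fps_const r * fps_X ^ 2 * g ^ 2"
  have nz: "fps_nth ?u 0 \<noteq> 0"
    by (simp add: power2_eq_square)
  then have u: "?u \<noteq> 0"
    by (metis fps_zero_nth)
  have m: "MINVERT r g * ?u = g"
    unfolding MINVERT_def using fps_divide_unit[OF nz, of g] inverse_mult_eq_1[OF nz]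
    by (simp only: mult.assoc mult_1_right)
  have "INVERT s (MINVERT r g)
      = (MINVERT r g * ?u) / ((1 - fps_const s * fps_X * MINVERT r g) * ?u)"
    unfolding INVERT_def by (rule fps_divide_cancel[OF u, symmetric])
  also have "(1 - fps_const s * fps_X * MINVERT r g) * ?u
      = ?u - fps_const s * fps_X * (MINVERT r g * ?u)"
    by (simp only: left_diff_distrib mult_1_left mult.assoc)
  finally show ?thesis
    unfolding m .
qed

theorem proposition11:
  fixes p q a :: real
  assumes "p > 0" and "q \<ge> 0"
  shows "free_meixner_mgf p q a = INVERT (- a) (MINVERT (p - q) (g_series a q))"
proof -
  define g where "g = g_series a q"
  let ?D = "1 - fps_const p * fps_X ^ 2 * g"
  have quad: "g * (1 - fps_const a * fps_X - fps_const q * fps_X ^ 2 * g) = 1"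
    unfolding g_def by (rule g_series_quadratic)
  then have "g \<noteq> 0"
    by auto
  \<comment> \<open>Only the term \<open>1\<close> is replaced, by the left-hand side of the quadratic equation: its multiples
     of \<open>a\<close> and \<open>q\<close> then cancel against those contributed by the transforms.\<close>
  have "1 - fps_const (p - q) * fps_X ^ 2 * g ^ 2 - fps_const (- a) * fps_X * g
      = g * (1 - fps_const a * fps_X - fps_const q * fps_X ^ 2 * g)
        - fps_const (p - q) * fps_X ^ 2 * g ^ 2 - fps_const (- a) * fps_X * g"
    unfolding quad ..
  also have "\<dots> = ?D * g"
    by (simp add: algebra_simps power2_eq_square flip: fps_const_sub fps_const_neg)
  finally have "INVERT (- a) (MINVERT (p - q) g) = (1 * g) / (?D * g)"
    unfolding INVERT_MINVERT by simp
  also have "\<dots> = 1 / ?D"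
    by (rule fps_divide_cancel) fact
  finally show ?thesis
    unfolding free_meixner_mgf_eq g_def by (rule sym)
qed

end
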